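(* Let $\mu_B$ be the invariant measure associated to the affine iterated function system $\tau_b(x)=\frac{1}{4}(x+b)$, $x\in\mathbb{R}$, $b\in B=\{0,1,4,5\}$. Then $\mu_B$ is not a spectral measure. There is, however, an infinite set $\Lambda\subset\mathbb{R}$ such that the family of exponential functions $(e_\lambda)_{\lambda\in\Lambda}$ is orthonormal in $L^2(\mu_B)$.
   Context: For $\lambda\in\mathbb{R}$, $e_\lambda(x)=e^{2\pi i\lambda x}$. The invariant measure $\mu_B$ is the unique Borel probability measure on $\mathbb{R}$ such that $\int f\,d\mu_B=\frac{1}{\#B}\sum_{b\in B}\int f\circ\tau_b\,d\mu_B$ for all $f\in C_c(\mathbb{R})$. A finite Borel measure $\mu$ on $\mathbb{R}$ is spectral if there is a set $\Lambda\subset\mathbb{R}$ such that the family $(e_\lambda)_{\lambda\in\Lambda}$ is an orthogonal basis of $L^2(\mu)$. *)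

theory Defs
  imports "HOL-Probability.Probability"
begin

definition affine_branch :: "real \<Rightarrow> real \<Rightarrow> real \<Rightarrow> real" where
  "affine_branch R b x = (x + b) / R"

definition Cc :: "(real \<Rightarrow> complex) set" where
  "Cc = {f. continuous_on UNIV f \<and> compact (closure {x. f x \<noteq> 0})}"

definition is_invariant_measure :: "real \<Rightarrow> real set \<Rightarrow> real measure \<Rightarrow> bool" where
  "is_invariant_measure R B M \<longleftrightarrow>
     sets M = sets borel \<and> prob_space M \<and>
     (\<forall>f\<in>Cc. (LINT x|M. f x) =
        (1 / of_nat (card B)) * (\<Sum>b\<in>B. LINT x|M. (f \<circ> affine_branch R b) x))"

text \<open>For finite nonempty \<open>B\<close> and \<open>\<bar>R\<bar> > 1\<close> the measure described here exists and
  is unique by Hutchinson's theorem; for other parameters this may fail.\<close>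

definition invariant_measure :: "real \<Rightarrow> real set \<Rightarrow> real measure" where
  "invariant_measure R B = (THE M. is_invariant_measure R B M)"

text \<open>Elements of \<open>L\<^sup>2(M)\<close> are represented by functions rather than by their classes
  modulo equality almost everywhere.\<close>

definition square_integrable :: "'a measure \<Rightarrow> ('a \<Rightarrow> complex) \<Rightarrow> bool" where
  "square_integrable M f \<longleftrightarrow>
     f \<in> borel_measurable M \<and> integrable M (\<lambda>x. (cmod (f x))\<^sup>2)"

definition L2_inner :: "'a measure \<Rightarrow> ('a \<Rightarrow> complex) \<Rightarrow> ('a \<Rightarrow> complex) \<Rightarrow> complex" where
  "L2_inner M f g = (LINT x|M. f x * cnj (g x))"

definition L2_norm :: "'a measure \<Rightarrow> ('a \<Rightarrow> complex) \<Rightarrow> real" where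
  "L2_norm M f = sqrt (LINT x|M. (cmod (f x))\<^sup>2)"

definition L2_orthogonal :: "'a measure \<Rightarrow> ('i \<Rightarrow> 'a \<Rightarrow> complex) \<Rightarrow> 'i set \<Rightarrow> bool" where
  "L2_orthogonal M e I \<longleftrightarrow>
     (\<forall>i\<in>I. square_integrable M (e i)) \<and>
     (\<forall>i\<in>I. \<forall>j\<in>I. i \<noteq> j \<longrightarrow> L2_inner M (e i) (e j) = 0)"

definition L2_orthonormal :: "'a measure \<Rightarrow> ('i \<Rightarrow> 'a \<Rightarrow> complex) \<Rightarrow> 'i set \<Rightarrow> bool" where
  "L2_orthonormal M e I \<longleftrightarrow>
     L2_orthogonal M e I \<and> (\<forall>i\<in>I. L2_norm M (e i) = 1)"

text \<open>A basis in the Hilbert space sense: the members are nonzero and their finite linear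
  combinations are dense in \<open>L\<^sup>2(M)\<close>.\<close>

definition L2_orthogonal_basis :: "'a measure \<Rightarrow> ('i \<Rightarrow> 'a \<Rightarrow> complex) \<Rightarrow> 'i set \<Rightarrow> bool" where
  "L2_orthogonal_basis M e I \<longleftrightarrow>
     L2_orthogonal M e I \<and> (\<forall>i\<in>I. L2_norm M (e i) \<noteq> 0) \<and>
     (\<forall>f. square_integrable M f \<longrightarrow>
        (\<forall>\<epsilon>>0. \<exists>F c. finite F \<and> F \<subseteq> I \<and>
           L2_norm M (\<lambda>x. f x - (\<Sum>i\<in>F. c i * e i x)) < \<epsilon>))"

definition expo :: "real \<Rightarrow> real \<Rightarrow> complex" where
  "expo l x = exp (2 * complex_of_real pi * \<i> * complex_of_real l * complex_of_real x)"

text \<open>Intended for finite Borel measures. Finiteness is not part of the predicate, so that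
  its negation cannot hold merely because a measure fails to be finite.\<close>

definition spectral_measure :: "real measure \<Rightarrow> bool" where
  "spectral_measure M \<longleftrightarrow> (\<exists>\<Lambda>. L2_orthogonal_basis M expo \<Lambda>)"

end

theory Submission
  imports Defs
begin

text \<open>
  Let \<open>\<mu>B\<close> be the invariant measure; it is supported on \<open>[0, 5/3]\<close>. Its characteristic function
  satisfies \<open>\<phi>(t) = (1 + exp(i t/4)) (1 + exp(i t)) \<phi>(t/4) / 4\<close>, hence vanishes at \<open>4\<^sup>k j \<pi>\<close> for
  odd \<open>j\<close>, so the frequencies \<open>4\<^sup>k / 2\<close> give orthogonal exponentials.

  On the other hand, since \<open>0 \<equiv> 4\<close> and \<open>1 \<equiv> 5\<close> modulo \<open>4\<close>, cylinders overlap, and the restriction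
  of \<open>\<mu>B\<close> to \<open>E' = [1/4, 1/2)\<close> is twice the translate by \<open>1/4\<close> of its restriction to
  \<open>E = [0, 1/4)\<close>. So for every \<open>\<lambda>\<close> the inner products of \<open>e\<^sub>\<lambda>\<close> with \<open>2 1\<^sub>E\<close> and with \<open>1\<^sub>E\<^sub>'\<close>
  have the same modulus, whereas the squared norms of these two functions are \<open>4 \<mu>B(E)\<close> and
  \<open>2 \<mu>B(E)\<close>. This contradicts Parseval's identity for an orthogonal basis of exponentials.
\<close>

subsection \<open>The invariant measure of an affine iterated function system\<close>

text \<open>Entries outside \<open>B\<close> are replaced by \<open>0\<close> so that the series converges for every sequence,
  not just almost surely.\<close>

definition ifs_point :: "real \<Rightarrow> real set \<Rightarrow> (nat \<Rightarrow> real) \<Rightarrow> real" where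
  "ifs_point R B \<omega> = (\<Sum>n. (if \<omega> n \<in> B then \<omega> n else 0) / R ^ Suc n)"

text \<open>The law of the random series whose digits are independent and uniform on
  \<open>B\<close>. It makes the invariant measure concrete enough to compute with.\<close>

definition ifs_measure :: "real \<Rightarrow> real set \<Rightarrow> real measure" where
  "ifs_measure R B =
     distr (Pi\<^sub>M (UNIV :: nat set) (\<lambda>_. measure_pmf (pmf_of_set B))) borel (ifs_point R B)"

lemma ifs_point_measurable [measurable]:
  "ifs_point R B \<in> borel_measurable (Pi\<^sub>M (UNIV :: nat set) (\<lambda>_. measure_pmf p))"
proof -
  have "(\<lambda>\<omega>. if \<omega> n \<in> B then \<omega> n else 0)
      \<in> borel_measurable (Pi\<^sub>M (UNIV :: nat set) (\<lambda>_. measure_pmf p))" for n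
    using measurable_compose[OF measurable_component_singleton[of n UNIV "\<lambda>_. measure_pmf p"],
        of "\<lambda>x. if x \<in> B then x else 0" borel] by simp
  then show ?thesis
    unfolding ifs_point_def by measurable
qed

text \<open>Prepending a digit shifts every later term by one place, which divides the tail by
  \<open>R\<close>. Thus the branches act on points as prepending acts on digit sequences.\<close>

lemma ifs_point_Cons:
  assumes "finite B" "\<bar>R\<bar> > 1" "b \<in> B"
  shows "ifs_point R B (case_nat b \<omega>) = affine_branch R b (ifs_point R B \<omega>)"
proof -
  define d where "d \<omega> n = (if \<omega> n \<in> B then \<omega> n else 0)" for \<omega> :: "nat \<Rightarrow> real" and n
  define C where "C = Max (abs ` B)"
  have C: "\<bar>x\<bar> \<le> C" if "x \<in> B" for x
    using that assms(1) by (simp add: C_def)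
  \<comment> \<open>Non-negativity lets \<open>C\<close> bound the default entry \<open>0\<close> as
    well.\<close>
  have "0 \<le> C"
    using C[OF assms(3)] by simp
  have summ: "summable (\<lambda>n. d \<omega> n / R ^ Suc n)" for \<omega>
  proof (rule summable_comparison_test')
    show "summable (\<lambda>n. C * (1 / \<bar>R\<bar>) ^ n)"
      using assms(2) by (intro summable_mult summable_geometric) simp
    show "norm (d \<omega> n / R ^ Suc n) \<le> C * (1 / \<bar>R\<bar>) ^ n" for n
    proof -
      have "\<bar>d \<omega> n\<bar> \<le> C"
        using C \<open>0 \<le> C\<close> by (auto simp: d_def)
      then have "\<bar>d \<omega> n\<bar> / \<bar>R\<bar> ^ Suc n \<le> C / \<bar>R\<bar> ^ n"
        using assms(2) \<open>0 \<le> C\<close> power_increasing[of n "Suc n" "\<bar>R\<bar>"]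
        by (intro frac_le) simp_all
      then show ?thesis
        by (simp add: power_abs abs_mult power_divide)
    qed
  qed
  have "ifs_point R B (case_nat b \<omega>) = (\<Sum>n. d (case_nat b \<omega>) n / R ^ Suc n)"
    by (simp add: ifs_point_def d_def)
  also have "\<dots> = b / R + (\<Sum>n. d (case_nat b \<omega>) (Suc n) / R ^ Suc (Suc n))"
    using suminf_split_head[OF summ[of "case_nat b \<omega>"]] assms(3) by (simp add: d_def)
  also have "(\<lambda>n. d (case_nat b \<omega>) (Suc n) / R ^ Suc (Suc n)) = (\<lambda>n. d \<omega> n / R ^ Suc n / R)"
    by (auto simp: d_def mult.commute)
  also have "(\<Sum>n. d \<omega> n / R ^ Suc n / R) = ifs_point R B \<omega> / R"
    using suminf_divide[OF summ[of \<omega>], of R] by (simp add: ifs_point_def d_def)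
  finally show ?thesis
    by (simp add: affine_branch_def add_divide_distrib)
qed

lemma affine_branch_measurable [measurable]: "affine_branch R b \<in> borel_measurable borel"
  unfolding affine_branch_def by measurable

lemma sets_ifs_measure [simp, measurable_cong]: "sets (ifs_measure R B) = sets borel"
  by (simp add: ifs_measure_def)

lemma space_ifs_measure [simp]: "space (ifs_measure R B) = UNIV"
  by (simp add: ifs_measure_def)

lemma real_distribution_ifs_measure: "real_distribution (ifs_measure R B)"
proof -
  interpret product_prob_space "\<lambda>_ :: nat. measure_pmf (pmf_of_set B)" UNIV
    by unfold_locales
  interpret prob_space "ifs_measure R B"
    unfolding ifs_measure_def by (rule prob_space_distr) simp
  show ?thesis
    by unfold_locales simp
qed

text \<open>Condition on the first digit: the remaining digits are independent of it and have the
  same joint law. Bounded Borel functions are allowed because indicators of intervals are integrated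
  later.\<close>

lemma integral_ifs_measure:
  fixes f :: "real \<Rightarrow> 'a :: {banach, second_countable_topology}"
  assumes B: "finite B" "B \<noteq> {}" and R: "\<bar>R\<bar> > 1"
    and f [measurable]: "f \<in> borel_measurable borel" and bound: "\<And>x. norm (f x) \<le> K"
  shows "(LINT x|ifs_measure R B. f x)
    = (\<Sum>b\<in>B. LINT x|ifs_measure R B. f (affine_branch R b x)) /\<^sub>R card B"
proof -
  define D where "D = measure_pmf (pmf_of_set B)"
  interpret D: prob_space D
    unfolding D_def by (rule measure_pmf.prob_space_axioms)
  interpret sequence_space D
    by unfold_locales
  interpret P: prob_space S
    by (rule prob_space_PiM) unfold_locales
  interpret DS: pair_prob_space D S
    by unfold_locales
  have X [measurable]: "ifs_point R B \<in> borel_measurable S"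
    unfolding D_def by measurable
  have [measurable]: "(\<lambda>(s, \<omega>). case_nat s \<omega>) \<in> D \<Otimes>\<^sub>M S \<rightarrow>\<^sub>M S"
    by measurable
  have M: "ifs_measure R B = distr S borel (ifs_point R B)"
    by (simp add: ifs_measure_def D_def)
  have "(LINT x|ifs_measure R B. f x) = (LINT \<omega>|S. f (ifs_point R B \<omega>))"
    unfolding M by (rule integral_distr) measurable
  \<comment> \<open>By \<open>PiM_iter\<close>, a digit drawn from \<open>D\<close> and prepended to
    an independent sequence with law \<open>S\<close> gives a sequence with law \<open>S\<close>
    again.\<close>
  also have "\<dots> = (LINT p|(D \<Otimes>\<^sub>M S). f (ifs_point R B (case_nat (fst p) (snd p))))"
    by (subst PiM_iter[symmetric], subst integral_distr) (auto simp: case_prod_beta)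
  also have "\<dots> = (LINT b|D. LINT \<omega>|S. f (ifs_point R B (case_nat b \<omega>)))"
    by (subst DS.integral_fst'[symmetric])
       (auto intro!: DS.integrable_const_bound[where B = K] simp: bound)
  also have "\<dots> = (\<Sum>b\<in>B. (LINT \<omega>|S. f (ifs_point R B (case_nat b \<omega>))) /\<^sub>R card B)"
    unfolding D_def using B by (subst integral_measure_pmf[of B]) (auto simp: pmf_of_set divide_inverse)
  also have "\<dots> = (\<Sum>b\<in>B. LINT \<omega>|S. f (affine_branch R b (ifs_point R B \<omega>))) /\<^sub>R card B"
    by (simp add: scaleR_sum_right ifs_point_Cons B R)
  also have "\<dots> = (\<Sum>b\<in>B. LINT x|ifs_measure R B. f (affine_branch R b x)) /\<^sub>R card B"
    unfolding M by (subst integral_distr) auto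
  finally show ?thesis .
qed

lemma is_invariant_measure_ifs_measure:
  assumes "finite B" "B \<noteq> {}" "\<bar>R\<bar> > 1"
  shows "is_invariant_measure R B (ifs_measure R B)"
proof -
  interpret real_distribution "ifs_measure R B"
    by (rule real_distribution_ifs_measure)
  have "(LINT x|ifs_measure R B. f x) =
      1 / of_nat (card B) * (\<Sum>b\<in>B. LINT x|ifs_measure R B. (f \<circ> affine_branch R b) x)"
    if "f \<in> Cc" for f
  proof -
    have cont: "continuous_on UNIV f" and comp: "compact (closure {x. f x \<noteq> 0})"
      using that by (auto simp: Cc_def)
    have "compact (f ` closure {x. f x \<noteq> 0})"
      by (intro compact_continuous_image comp continuous_on_subset[OF cont]) auto
    then obtain K where "K > 0" and K: "\<And>x. x \<in> closure {x. f x \<noteq> 0} \<Longrightarrow> norm (f x) \<le> K"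
      by (auto dest!: compact_imp_bounded simp: bounded_pos)
    have "norm (f x) \<le> K" for x
      using K[of x] \<open>K > 0\<close> closure_subset[of "{x. f x \<noteq> 0}"] by (cases "f x = 0") auto
    from integral_ifs_measure[OF assms borel_measurable_continuous_onI[OF cont] this] show ?thesis
      by (simp add: scaleR_conv_of_real divide_inverse)
  qed
  then show ?thesis
    by (simp add: is_invariant_measure_def prob_space_axioms)
qed

text \<open>The exponentials are not compactly supported, so invariance is applied to truncations of them.\<close>

lemma char_invariant_measure:
  assumes inv: "is_invariant_measure R B M" and "finite B"
  shows "char M t = (\<Sum>b\<in>B. iexp (t * b / R)) / of_nat (card B) * char M (t / R)"
proof -
  interpret real_distribution M
    using inv by (simp add: is_invariant_measure_def real_distribution_def real_distribution_axioms_def)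
  \<comment> \<open>Continuous cutoff: \<open>1\<close> on \<open>[-n, n]\<close>, linear on the
    next unit interval on each side, \<open>0\<close> beyond.\<close>
  define c where "c n x = complex_of_real (max 0 (min 1 (real n + 1 - \<bar>x\<bar>)))" for n x
  define f where "f n x = iexp (t * x) * c n x" for n x
  have fm [measurable]: "f n \<in> borel_measurable borel" for n
    unfolding f_def c_def by measurable
  have fb: "norm (f n x) \<le> 1" for n x
    by (simp add: f_def c_def norm_mult)
  have "f n \<in> Cc" for n
  proof -
    have "continuous_on UNIV (f n)"
      unfolding f_def c_def by (intro continuous_intros)
    moreover have "{x. f n x \<noteq> 0} \<subseteq> cball 0 (real n + 1)"
      by (auto simp: f_def c_def max_def min_def split: if_splits)
    then have "bounded {x. f n x \<noteq> 0}"
      using bounded_cball bounded_subset by blast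
    ultimately show ?thesis
      by (simp add: Cc_def)
  qed
  then have eq: "(LINT x|M. f n x) = 1 / of_nat (card B) * (\<Sum>b\<in>B. LINT x|M. f n (affine_branch R b x))" for n
    using inv by (simp add: is_invariant_measure_def)
  have lim: "(\<lambda>n. f n x) \<longlonglongrightarrow> iexp (t * x)" for x
  proof (rule tendsto_eventually)
    have "f n x = iexp (t * x)" if "n \<ge> nat \<lceil>\<bar>x\<bar>\<rceil>" for n
    proof -
      have "\<bar>x\<bar> \<le> real n"
        using that by linarith
      then show ?thesis by (simp add: f_def c_def)
    qed
    then show "\<forall>\<^sub>F n in sequentially. f n x = iexp (t * x)"
      unfolding eventually_sequentially by blast
  qed
  have lim_comp: "(\<lambda>n. LINT x|M. f n (g x)) \<longlonglongrightarrow> (LINT x|M. iexp (t * g x))"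
    if [measurable]: "g \<in> borel_measurable borel" for g
    by (rule integral_dominated_convergence[where w = "\<lambda>_. 1"]) (use lim fb in auto)
  have "(\<lambda>n. LINT x|M. f n x) \<longlonglongrightarrow>
      1 / of_nat (card B) * (\<Sum>b\<in>B. LINT x|M. iexp (t * affine_branch R b x))"
    unfolding eq by (intro tendsto_intros lim_comp) measurable
  moreover have "(\<lambda>n. LINT x|M. f n x) \<longlonglongrightarrow> char M t"
    unfolding char_def by (rule lim_comp) measurable
  ultimately have "char M t = 1 / of_nat (card B) * (\<Sum>b\<in>B. LINT x|M. iexp (t * affine_branch R b x))"
    by (rule LIMSEQ_unique[rotated])
  also have "(\<lambda>b. LINT x|M. iexp (t * affine_branch R b x)) = (\<lambda>b. iexp (t * b / R) * char M (t / R))"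
  proof
    fix b
    have "(LINT x|M. iexp (t * affine_branch R b x)) = (LINT x|M. iexp (t * b / R) * iexp (t / R * x))"
      by (intro Bochner_Integration.integral_cong refl)
         (simp add: affine_branch_def add_divide_distrib ring_distribs exp_add[symmetric] add.commute)
    then show "(LINT x|M. iexp (t * affine_branch R b x)) = iexp (t * b / R) * char M (t / R)"
      by (simp add: char_def)
  qed
  finally show ?thesis
    by (simp add: sum_distrib_right)
qed

section \<open>Uniqueness of the invariant measure\<close>

text \<open>The difference of two characteristic functions obeys \<open>D t = m * D (t / R)\<close>
  with a factor of modulus at most \<open>1\<close>. Iterating pushes the argument to
  \<open>0\<close>, where \<open>D\<close> is continuous and vanishes.\<close>

lemma is_invariant_measure_unique:
  assumes B: "finite B" and R: "\<bar>R\<bar> > 1"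
    and inv: "is_invariant_measure R B M" "is_invariant_measure R B N"
  shows "M = N"
proof -
  interpret M: real_distribution M
    using inv by (simp add: is_invariant_measure_def real_distribution_def real_distribution_axioms_def)
  interpret N: real_distribution N
    using inv by (simp add: is_invariant_measure_def real_distribution_def real_distribution_axioms_def)
  define D where "D t = char M t - char N t" for t
  have step: "norm (D t) \<le> norm (D (t / R))" for t
  proof -
    define m where "m = (\<Sum>b\<in>B. iexp (t * b / R)) / of_nat (card B)"
    have "norm (\<Sum>b\<in>B. iexp (t * b / R)) \<le> (\<Sum>b\<in>B. 1)"
      by (rule sum_norm_le) simp
    \<comment> \<open>For empty \<open>B\<close> the quotient is \<open>0\<close>, since division by
      \<open>0\<close> yields \<open>0\<close>.\<close>
    then have "norm m \<le> 1"
      by (cases "card B = 0") (simp_all add: m_def norm_divide)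
    have "D t = m * D (t / R)"
      unfolding D_def m_def right_diff_distrib
      using char_invariant_measure[OF inv(1) B, of t] char_invariant_measure[OF inv(2) B, of t]
      by (simp only:)
    with \<open>norm m \<le> 1\<close> show ?thesis
      by (simp add: norm_mult mult_left_le_one_le)
  qed
  have iter: "norm (D t) \<le> norm (D (t * (1 / R) ^ n))" for t n
  proof (induction n)
    case (Suc n)
    then show ?case
      using step[of "t * (1 / R) ^ n"] by (simp add: mult.commute)
  qed simp
  have "D t = 0" for t
  proof -
    have "(\<lambda>n. (1 / R) ^ n) \<longlonglongrightarrow> 0"
      using R by (intro LIMSEQ_power_zero) simp
    then have "(\<lambda>n. t * (1 / R) ^ n) \<longlonglongrightarrow> 0"
      by (rule tendsto_mult_right_zero)
    moreover have "isCont D 0"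
      unfolding D_def by (intro continuous_intros M.isCont_char N.isCont_char)
    ultimately have "(\<lambda>n. norm (D (t * (1 / R) ^ n))) \<longlonglongrightarrow> norm (D 0)"
      by (intro tendsto_norm isCont_tendsto_compose[of 0 D])
    then have "norm (D t) \<le> norm (D 0)"
      by (rule LIMSEQ_le_const) (use iter in auto)
    then show ?thesis
      by (simp add: D_def M.char_zero N.char_zero)
  qed
  then have "char M = char N"
    by (auto simp: D_def)
  then show ?thesis
    by (intro Levy_uniqueness M.real_distribution_axioms N.real_distribution_axioms)
qed

lemma invariant_measure_eq:
  assumes "finite B" "B \<noteq> {}" "\<bar>R\<bar> > 1"
  shows "invariant_measure R B = ifs_measure R B"
  unfolding invariant_measure_def
  using is_invariant_measure_ifs_measure[OF assms] is_invariant_measure_unique[OF assms(1,3)]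
  by (intro the_equality) auto

text \<open>The branches contract the distance to \<open>K\<close> by \<open>\<bar>R\<bar>\<close>, so the integral of
  \<open>min 1 (infdist x K / \<bar>R\<bar>\<^sup>n)\<close>, which tends to \<open>0\<close>, is increasing in \<open>n\<close>.\<close>

lemma AE_ifs_measure_in_invariant_set:
  assumes B: "finite B" "B \<noteq> {}" and R: "\<bar>R\<bar> > 1"
    and K: "closed K" "K \<noteq> {}" "\<And>b x. b \<in> B \<Longrightarrow> x \<in> K \<Longrightarrow> affine_branch R b x \<in> K"
  shows "AE x in ifs_measure R B. x \<in> K"
proof -
  interpret real_distribution "ifs_measure R B"
    by (rule real_distribution_ifs_measure)
  define h where "h n x = min 1 (infdist x K / \<bar>R\<bar> ^ n)" for n :: nat and x
  have [measurable]: "h n \<in> borel_measurable borel" for n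
    unfolding h_def by (intro borel_measurable_continuous_onI continuous_intros) (use R in auto)
  have h0: "0 \<le> h n x" for n x
    by (simp add: h_def infdist_nonneg)
  have h1: "h n x \<le> 1" for n x
    by (simp add: h_def)
  have hint: "integrable (ifs_measure R B) (\<lambda>x. h n (g x))"
    if [measurable]: "g \<in> borel_measurable borel" for n g
    by (rule integrable_const_bound[of _ 1]) (auto simp: h0 h1 abs_le_iff intro: order_trans[OF _ h0])
  have contract: "h n (affine_branch R b x) \<le> h (Suc n) x" if "b \<in> B" for n b x
  proof -
    \<comment> \<open>A nearest point exists because \<open>K\<close> is closed. Its image stays in
      \<open>K\<close>, so it bounds the distance of the image of \<open>x\<close>.\<close>
    obtain y where y: "y \<in> K" "infdist x K = dist x y"
      using infdist_attains_inf K(1,2) by blast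
    have "infdist (affine_branch R b x) K \<le> dist (affine_branch R b x) (affine_branch R b y)"
      using K(3)[OF that y(1)] by (rule infdist_le)
    also have "\<dots> = infdist x K / \<bar>R\<bar>"
      by (simp add: y(2) affine_branch_def dist_real_def diff_divide_distrib[symmetric])
    finally have "infdist (affine_branch R b x) K / \<bar>R\<bar> ^ n \<le> infdist x K / \<bar>R\<bar> / \<bar>R\<bar> ^ n"
      by (rule divide_right_mono) simp
    then show ?thesis
      unfolding h_def by (intro min.mono) (simp_all add: mult.commute)
  qed
  have step: "(LINT x|ifs_measure R B. h n x) \<le> (LINT x|ifs_measure R B. h (Suc n) x)" for n
  proof -
    have "(LINT x|ifs_measure R B. h n x) =
        (\<Sum>b\<in>B. LINT x|ifs_measure R B. h n (affine_branch R b x)) / card B"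
      using integral_ifs_measure[OF B R, of "h n" 1] h0 h1 by (simp add: divide_inverse mult.commute)
    also have "\<dots> \<le> (\<Sum>b\<in>B. LINT x|ifs_measure R B. h (Suc n) x) / card B"
      by (intro divide_right_mono sum_mono integral_mono hint contract hint[of "\<lambda>x. x", simplified]) auto
    also have "\<dots> = (LINT x|ifs_measure R B. h (Suc n) x)"
      using B by simp
    finally show ?thesis .
  qed
  have "(\<lambda>n. LINT x|ifs_measure R B. h n x) \<longlonglongrightarrow> (LINT x|ifs_measure R B. 0)"
  proof (rule integral_dominated_convergence[where w = "\<lambda>_. 1"])
    have "(\<lambda>n. h n x) \<longlonglongrightarrow> 0" for x
    proof -
      have "(\<lambda>n. infdist x K * (1 / \<bar>R\<bar>) ^ n) \<longlonglongrightarrow> 0"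
        using R by (intro tendsto_mult_right_zero LIMSEQ_power_zero) simp
      then have "(\<lambda>n. min 1 (infdist x K * (1 / \<bar>R\<bar>) ^ n)) \<longlonglongrightarrow> min 1 0"
        by (intro tendsto_min tendsto_const)
      then show ?thesis
        by (simp add: h_def power_divide)
    qed
    then show "AE x in ifs_measure R B. (\<lambda>n. h n x) \<longlonglongrightarrow> 0"
      by simp
  qed (auto simp: h0 h1)
  moreover have "incseq (\<lambda>n. LINT x|ifs_measure R B. h n x)"
    using step by (rule incseq_SucI)
  \<comment> \<open>An increasing sequence with limit \<open>0\<close> has no positive term.\<close>
  ultimately have "(LINT x|ifs_measure R B. h 0 x) \<le> 0"
    using incseq_le by fastforce
  then have "(LINT x|ifs_measure R B. h 0 x) = 0"
    by (intro antisym integral_nonneg_AE) (auto simp: h0)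
  then have "AE x in ifs_measure R B. h 0 x = 0"
    using integral_nonneg_eq_0_iff_AE[OF hint[of "\<lambda>x. x" 0]] by (auto simp: h0)
  \<comment> \<open>\<open>h 0 x\<close> is \<open>min 1 (infdist x K)\<close>, which vanishes only
    on the closed set \<open>K\<close>.\<close>
  then show ?thesis
    by eventually_elim
       (use in_closed_iff_infdist_zero[OF K(1,2)] infdist_nonneg in \<open>auto simp: h_def min_def split: if_splits\<close>)
qed

subsection \<open>Orthogonal bases in the space of square integrable functions\<close>

lemma cmod_diff_power2:
  "(cmod (x - y))\<^sup>2 = (cmod x)\<^sup>2 + (cmod y)\<^sup>2 - 2 * Re (x * cnj y)"
  unfolding cmod_power2 by (simp add: power2_eq_square algebra_simps)

lemma square_integrable_mult_cnj:
  assumes "square_integrable M f" "square_integrable M g"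
  shows "integrable M (\<lambda>x. f x * cnj (g x))"
proof (rule Bochner_Integration.integrable_bound)
  show "integrable M (\<lambda>x. (cmod (f x))\<^sup>2 + (cmod (g x))\<^sup>2)"
    using assms by (simp add: square_integrable_def)
  have [measurable]: "f \<in> borel_measurable M" "g \<in> borel_measurable M"
    using assms by (simp_all add: square_integrable_def)
  have [measurable]: "cnj \<in> borel_measurable borel"
    by (intro borel_measurable_continuous_onI continuous_intros)
  show "(\<lambda>x. f x * cnj (g x)) \<in> borel_measurable M"
    by measurable
  have "cmod (f x) * cmod (g x) \<le> (cmod (f x))\<^sup>2 + (cmod (g x))\<^sup>2" for x
    using sum_squares_bound[of "cmod (f x)" "cmod (g x)"]
      mult_nonneg_nonneg[OF norm_ge_zero norm_ge_zero, of "f x" "g x"] by linarith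
  then show "AE x in M. norm (f x * cnj (g x)) \<le> norm ((cmod (f x))\<^sup>2 + (cmod (g x))\<^sup>2)"
    by (simp add: norm_mult)
qed

lemma square_integrable_mult_left:
  assumes "square_integrable M f"
  shows "square_integrable M (\<lambda>x. c * f x)"
  using assms by (auto simp: square_integrable_def norm_mult power_mult_distrib)

lemma square_integrable_diff:
  assumes f: "square_integrable M f" and g: "square_integrable M g"
  shows "square_integrable M (\<lambda>x. f x - g x)"
proof -
  have [measurable]: "f \<in> borel_measurable M" "g \<in> borel_measurable M"
    using assms by (simp_all add: square_integrable_def)
  have "integrable M (\<lambda>x. (cmod (f x))\<^sup>2 + (cmod (g x))\<^sup>2 - 2 * Re (f x * cnj (g x)))"
    using square_integrable_mult_cnj[OF f g] f g
    by (intro Bochner_Integration.integrable_diff Bochner_Integration.integrable_add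
        integrable_mult_right integrable_Re)
       (simp_all add: square_integrable_def)
  then show ?thesis
    unfolding square_integrable_def cmod_diff_power2 by simp
qed

lemma L2_inner_diff_left:
  assumes "square_integrable M f" "square_integrable M g" "square_integrable M h"
  shows "L2_inner M (\<lambda>x. f x - g x) h = L2_inner M f h - L2_inner M g h"
  using assms by (simp add: L2_inner_def left_diff_distrib square_integrable_mult_cnj)

lemma L2_inner_mult_left: "L2_inner M (\<lambda>x. c * f x) g = c * L2_inner M f g"
  by (simp add: L2_inner_def mult.assoc)

lemma L2_norm_power2: "(L2_norm M f)\<^sup>2 = (LINT x|M. (cmod (f x))\<^sup>2)"
  by (simp add: L2_norm_def)

lemma L2_norm_nonneg: "0 \<le> L2_norm M f"
  by (simp add: L2_norm_def)

text \<open>Expand the square and complete it in \<open>c\<close>; the best coefficient is the inner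
  product with \<open>e\<close>.\<close>

lemma L2_norm_diff_mult_power2:
  assumes f: "square_integrable M f" and e: "square_integrable M e" "L2_norm M e = 1"
  shows "(L2_norm M (\<lambda>x. f x - c * e x))\<^sup>2
    = (L2_norm M f)\<^sup>2 - (cmod (L2_inner M f e))\<^sup>2 + (cmod (c - L2_inner M f e))\<^sup>2"
proof -
  note ce = square_integrable_mult_left[OF e(1), of c]
  note int = square_integrable_mult_cnj[OF f ce]
  have "(L2_norm M (\<lambda>x. f x - c * e x))\<^sup>2 =
      (LINT x|M. (cmod (f x))\<^sup>2 + (cmod (c * e x))\<^sup>2 - 2 * Re (f x * cnj (c * e x)))"
    by (simp only: L2_norm_power2 cmod_diff_power2)
  also have "\<dots> = (LINT x|M. (cmod (f x))\<^sup>2) + (LINT x|M. (cmod (c * e x))\<^sup>2)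
      - 2 * (LINT x|M. Re (f x * cnj (c * e x)))"
    using f ce integrable_Re[OF int] unfolding square_integrable_def
    by (simp only: Bochner_Integration.integral_diff Bochner_Integration.integral_add
        Bochner_Integration.integrable_add integrable_mult_right integral_mult_right_zero)
  also have "(LINT x|M. Re (f x * cnj (c * e x))) = Re (LINT x|M. f x * cnj (c * e x))"
    by (rule integral_Re[OF int])
  also have "(LINT x|M. f x * cnj (c * e x)) = cnj c * L2_inner M f e"
    unfolding L2_inner_def integral_mult_right_zero[symmetric] by (simp add: mult.left_commute)
  also have "(LINT x|M. (cmod (c * e x))\<^sup>2) = (cmod c)\<^sup>2 * (L2_norm M e)\<^sup>2"
    by (simp add: L2_norm_power2 norm_mult power_mult_distrib)
  finally show ?thesis
    unfolding e(2) cmod_diff_power2 L2_norm_power2 by (simp add: mult.commute)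
qed

text \<open>Members are subtracted one at a time. The identity serves twice: dropping the last sum
  bounds the error of any approximation from below, and choosing \<open>c\<close> as the inner
  products gives Bessel's inequality.\<close>

lemma L2_norm_diff_sum_power2:
  assumes e: "L2_orthonormal M e I" and "finite F" "F \<subseteq> I" and f: "square_integrable M f"
  shows "(L2_norm M (\<lambda>x. f x - (\<Sum>i\<in>F. c i * e i x)))\<^sup>2 = (L2_norm M f)\<^sup>2
      - (\<Sum>i\<in>F. (cmod (L2_inner M f (e i)))\<^sup>2) + (\<Sum>i\<in>F. (cmod (c i - L2_inner M f (e i)))\<^sup>2)"
proof -
  define r where "r F x = f x - (\<Sum>i\<in>F. c i * e i x)" for F x
  have sq: "square_integrable M (e i)" if "i \<in> I" for i
    using e that by (simp add: L2_orthonormal_def L2_orthogonal_def)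
  have "square_integrable M (r F) \<and> (\<forall>k\<in>I - F. L2_inner M (r F) (e k) = L2_inner M f (e k)) \<and>
      (L2_norm M (r F))\<^sup>2 = (L2_norm M f)\<^sup>2 - (\<Sum>i\<in>F. (cmod (L2_inner M f (e i)))\<^sup>2)
        + (\<Sum>i\<in>F. (cmod (c i - L2_inner M f (e i)))\<^sup>2)"
    using assms(2,3)
  proof (induction F rule: finite_induct)
    case empty
    then show ?case
      using f by (simp add: r_def)
  next
    case (insert j F)
    then have IH: "square_integrable M (r F)"
        "\<And>k. k \<in> I - F \<Longrightarrow> L2_inner M (r F) (e k) = L2_inner M f (e k)"
        "(L2_norm M (r F))\<^sup>2 = (L2_norm M f)\<^sup>2 - (\<Sum>i\<in>F. (cmod (L2_inner M f (e i)))\<^sup>2)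
          + (\<Sum>i\<in>F. (cmod (c i - L2_inner M f (e i)))\<^sup>2)"
      and j: "j \<in> I" "j \<notin> F"
      by auto
    have r: "r (insert j F) = (\<lambda>x. r F x - c j * e j x)"
      using insert.hyps by (auto simp: r_def)
    note sj = square_integrable_mult_left[OF sq[OF j(1)], of "c j"]
    have "square_integrable M (r (insert j F))"
      unfolding r by (rule square_integrable_diff[OF IH(1) sj])
    moreover have "L2_inner M (r (insert j F)) (e k) = L2_inner M f (e k)" if "k \<in> I - insert j F" for k
    proof -
      have "L2_inner M (e j) (e k) = 0"
        using e that j by (auto simp: L2_orthonormal_def L2_orthogonal_def)
      then show ?thesis
        using IH(2)[of k] that j
        by (simp add: r L2_inner_diff_left[OF IH(1) sj sq] L2_inner_mult_left)
    qed
    moreover have "L2_norm M (e j) = 1"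
      using e j by (simp add: L2_orthonormal_def)
    ultimately show ?case
      using L2_norm_diff_mult_power2[OF IH(1) sq[OF j(1)], of "c j"] IH(2)[of j] IH(3) j insert.hyps
      by (simp flip: r)
  qed
  then show ?thesis
    unfolding r_def by blast
qed

text \<open>Replaces Parseval's identity by finite sums: density brings the coefficient sums of
  \<open>f\<close> close to its squared norm, while Bessel's inequality bounds those of
  \<open>g\<close> by its squared norm.\<close>

lemma L2_orthogonal_basis_norm_mono:
  assumes basis: "L2_orthogonal_basis M e I" and e1: "\<And>i. i \<in> I \<Longrightarrow> L2_norm M (e i) = 1"
    and f: "square_integrable M f" and g: "square_integrable M g"
    and le: "\<And>i. i \<in> I \<Longrightarrow> cmod (L2_inner M f (e i)) \<le> cmod (L2_inner M g (e i))"
  shows "L2_norm M f \<le> L2_norm M g"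
proof (rule ccontr)
  assume *: "\<not> ?thesis"
  have on: "L2_orthonormal M e I"
    using basis e1 by (simp add: L2_orthogonal_basis_def L2_orthonormal_def)
  \<comment> \<open>Its square is exactly the gap between the squared norms, so a finite coefficient
    sum of \<open>f\<close> already exceeds the squared norm of \<open>g\<close>.\<close>
  define \<epsilon> where "\<epsilon> = sqrt ((L2_norm M f)\<^sup>2 - (L2_norm M g)\<^sup>2)"
  have sq: "(L2_norm M g)\<^sup>2 < (L2_norm M f)\<^sup>2"
    using * L2_norm_nonneg by (intro power_strict_mono) auto
  then have "\<epsilon> > 0"
    by (simp add: \<epsilon>_def)
  then obtain F c where F: "finite F" "F \<subseteq> I"
    and less: "L2_norm M (\<lambda>x. f x - (\<Sum>i\<in>F. c i * e i x)) < \<epsilon>"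
    using basis f unfolding L2_orthogonal_basis_def by blast
  have "(L2_norm M f)\<^sup>2 - (\<Sum>i\<in>F. (cmod (L2_inner M f (e i)))\<^sup>2)
      \<le> (L2_norm M (\<lambda>x. f x - (\<Sum>i\<in>F. c i * e i x)))\<^sup>2"
    unfolding L2_norm_diff_sum_power2[OF on F f] by (simp add: sum_nonneg)
  also have "\<dots> < \<epsilon>\<^sup>2"
    using less L2_norm_nonneg by (intro power_strict_mono) auto
  also have "\<dots> = (L2_norm M f)\<^sup>2 - (L2_norm M g)\<^sup>2"
    using sq by (simp add: \<epsilon>_def)
  finally have "(L2_norm M g)\<^sup>2 < (\<Sum>i\<in>F. (cmod (L2_inner M f (e i)))\<^sup>2)"
    by simp
  also have "\<dots> \<le> (\<Sum>i\<in>F. (cmod (L2_inner M g (e i)))\<^sup>2)"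
    using F le by (intro sum_mono power_mono) auto
  \<comment> \<open>Bessel's inequality: with these coefficients the last sum of the identity
    vanishes.\<close>
  also have "\<dots> \<le> (L2_norm M g)\<^sup>2"
    using L2_norm_diff_sum_power2[OF on F g, of "\<lambda>i. L2_inner M g (e i)"]
      zero_le_power2[of "L2_norm M (\<lambda>x. g x - (\<Sum>i\<in>F. L2_inner M g (e i) * e i x))"]
    by simp
  finally show False
    by simp
qed

subsection \<open>The digits 0, 1, 4, 5 in base 4\<close>

lemma expo_eq_iexp: "expo l x = iexp (2 * pi * l * x)"
  by (simp add: expo_def mult.commute mult.left_commute)

lemma expo_add: "expo l (x + y) = expo l x * expo l y"
  by (simp add: expo_def ring_distribs exp_add)

lemma norm_expo [simp]: "cmod (expo l x) = 1"
  by (simp add: expo_eq_iexp del: of_real_mult)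

lemma expo_measurable [measurable]: "expo l \<in> borel_measurable borel"
  unfolding expo_def by (intro borel_measurable_continuous_onI continuous_intros)

lemma (in real_distribution) square_integrable_bounded:
  assumes "f \<in> borel_measurable borel" "\<And>x. cmod (f x) \<le> K"
  shows "square_integrable M f"
proof -
  have [measurable]: "f \<in> borel_measurable M"
    using assms(1) by (simp cong: measurable_cong_sets)
  have "integrable M (\<lambda>x. (cmod (f x))\<^sup>2)"
    by (intro integrable_const_bound[of _ "K\<^sup>2"]) (auto intro!: power_mono assms(2))
  then show ?thesis
    by (simp add: square_integrable_def)
qed

lemma (in real_distribution) L2_norm_expo: "L2_norm M (expo l) = 1"
  using prob_space by (simp add: L2_norm_def)

text \<open>Turns orthogonality into zeros of the characteristic function; \<open>2 * pi\<close>
  converts between the two normalisations of the exponential.\<close>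

lemma (in real_distribution) L2_inner_expo:
  "L2_inner M (expo l) (expo k) = char M (2 * pi * (l - k))"
  unfolding L2_inner_def char_def
  by (intro Bochner_Integration.integral_cong refl)
     (simp add: expo_def exp_cnj exp_add[symmetric] algebra_simps)

abbreviation "\<mu>B \<equiv> ifs_measure 4 {0, 1, 4, 5}"

text \<open>The digit set is the direct sum of \<open>{0, 1}\<close> and \<open>{0, 4}\<close>, so
  its exponential sum factors.\<close>

lemma char_\<mu>B_step: "char \<mu>B t = (1 + iexp (t / 4)) * (1 + iexp t) / 4 * char \<mu>B (t / 4)"
proof -
  have "char \<mu>B t = (1 + iexp (t / 4) + iexp t + iexp (t * 5 / 4)) / 4 * char \<mu>B (t / 4)"
    using char_invariant_measure[OF is_invariant_measure_ifs_measure, of "{0, 1, 4, 5}" 4 t]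
    by (simp add: add.assoc)
  also have "iexp (t * 5 / 4) = iexp (t / 4) * iexp t"
    by (simp add: exp_add[symmetric] field_simps)
  finally show ?thesis
    by (simp add: algebra_simps)
qed

text \<open>The factor \<open>1 + iexp t\<close> vanishes at odd multiples of \<open>pi\<close>, and
  the recursion carries a zero at \<open>t / 4\<close> to \<open>t\<close>.\<close>

lemma char_\<mu>B_eq_0:
  assumes "odd j"
  shows "char \<mu>B (4 ^ k * (of_int j * pi)) = 0"
proof (induction k)
  case 0
  have "iexp (of_int j * pi) = -1"
    using assms cos_npi_int[of j] sin_npi_int[of j]
    by (simp add: cis_conv_exp[symmetric] complex_eq_iff mult.commute del: of_real_mult)
  then show ?case
    using char_\<mu>B_step[of "of_int j * pi"] by simp
next
  case (Suc k)
  then show ?case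
    using char_\<mu>B_step[of "4 ^ Suc k * (of_int j * pi)"] by simp
qed

lemma \<mu>B_orthonormal_expo: "L2_orthonormal \<mu>B expo (range (\<lambda>k. 4 ^ k / 2))"
proof -
  interpret real_distribution \<mu>B
    by (rule real_distribution_ifs_measure)
  \<comment> \<open>The sign \<open>s\<close> covers both orders of the indices. The integer
    \<open>1 - 4 ^ Suc n\<close> left after factoring out \<open>4 ^ k\<close> is odd.\<close>
  have zero: "char \<mu>B (2 * pi * (of_int s * (4 ^ k / 2 - 4 ^ l / 2))) = 0"
    if "k < l" "odd s" for k l :: nat and s :: int
  proof -
    obtain n where l: "l = Suc (k + n)"
      using \<open>k < l\<close> less_iff_Suc_add by auto
    have odd: "odd (s * (1 - 4 ^ Suc n))"
      using that by simp
    have eq: "2 * pi * (of_int s * (4 ^ k / 2 - 4 ^ l / 2)) =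
        4 ^ k * (of_int (s * (1 - 4 ^ Suc n)) * pi)"
      by (simp add: l power_add algebra_simps)
    show ?thesis
      unfolding eq by (rule char_\<mu>B_eq_0[OF odd])
  qed
  have "char \<mu>B (2 * pi * (4 ^ k / 2 - 4 ^ l / 2)) = 0" if "k \<noteq> l" for k l :: nat
    using that zero[of k l 1] zero[of l k "-1"] by (cases "k < l") auto
  then show ?thesis
    by (auto simp: L2_orthonormal_def L2_orthogonal_def L2_norm_expo L2_inner_expo
        intro!: square_integrable_bounded[where K = 1])
qed

section \<open>Self-similarity and overlapping cylinders\<close>

text \<open>The endpoints are the fixed points of the branches with the extreme digits
  \<open>0\<close> and \<open>5\<close>.\<close>

lemma AE_\<mu>B: "AE x in \<mu>B. x \<in> {0..5/3}"
  by (rule AE_ifs_measure_in_invariant_set) (auto simp: affine_branch_def)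

text \<open>Each pullback need only be known on the interval carrying the measure, so the identities
  below reduce to deciding which branches reach a given interval.\<close>

lemma integral_\<mu>B_piecewise:
  fixes f :: "real \<Rightarrow> complex"
  assumes [measurable]: "f \<in> borel_measurable borel" "f0 \<in> borel_measurable borel"
      "f1 \<in> borel_measurable borel" "f4 \<in> borel_measurable borel" "f5 \<in> borel_measurable borel"
    and bound: "\<And>x. cmod (f x) \<le> K"
    and eq: "\<And>x. x \<in> {0..5/3} \<Longrightarrow> f (x / 4) = f0 x"
      "\<And>x. x \<in> {0..5/3} \<Longrightarrow> f ((x + 1) / 4) = f1 x"
      "\<And>x. x \<in> {0..5/3} \<Longrightarrow> f ((x + 4) / 4) = f4 x"
      "\<And>x. x \<in> {0..5/3} \<Longrightarrow> f ((x + 5) / 4) = f5 x"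
  shows "(LINT x|\<mu>B. f x) =
    ((LINT x|\<mu>B. f0 x) + (LINT x|\<mu>B. f1 x) + (LINT x|\<mu>B. f4 x) + (LINT x|\<mu>B. f5 x)) / 4"
proof -
  have cong: "(LINT x|\<mu>B. g x) = (LINT x|\<mu>B. h x)"
    if [measurable]: "g \<in> borel_measurable borel" "h \<in> borel_measurable borel"
      and "\<And>x. x \<in> {0..5/3} \<Longrightarrow> g x = h x" for g h :: "real \<Rightarrow> complex"
    by (rule integral_cong_AE) (use AE_\<mu>B that(3) in auto)
  have "(LINT x|\<mu>B. f x) = ((LINT x|\<mu>B. f (x / 4)) + (LINT x|\<mu>B. f ((x + 1) / 4))
      + (LINT x|\<mu>B. f ((x + 4) / 4)) + (LINT x|\<mu>B. f ((x + 5) / 4))) / 4"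
    using integral_ifs_measure[of "{0, 1, 4, 5}" 4 f K] bound
    by (simp add: affine_branch_def scaleR_conv_of_real add.assoc)
  also have "(LINT x|\<mu>B. f (x / 4)) = (LINT x|\<mu>B. f0 x)"
    by (rule cong) (use eq in measurable)
  also have "(LINT x|\<mu>B. f ((x + 1) / 4)) = (LINT x|\<mu>B. f1 x)"
    by (rule cong) (use eq in measurable)
  also have "(LINT x|\<mu>B. f ((x + 4) / 4)) = (LINT x|\<mu>B. f4 x)"
    by (rule cong) (use eq in measurable)
  also have "(LINT x|\<mu>B. f ((x + 5) / 4)) = (LINT x|\<mu>B. f5 x)"
    by (rule cong) (use eq in measurable)
  finally show ?thesis .
qed

text \<open>On the support, digits \<open>0, 1\<close> lead into \<open>[0, 1)\<close> and digits
  \<open>4, 5\<close> into \<open>[1, 2)\<close>. Adding \<open>4\<close> to a digit translates its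
  branch by \<open>1\<close>.\<close>

lemma integral_\<mu>B_translate_1:
  fixes h :: "real \<Rightarrow> complex"
  assumes [measurable]: "h \<in> borel_measurable borel" and h: "\<And>x. cmod (h x) \<le> K"
  shows "(LINT x|\<mu>B. indicator {1..<2} x * h x) = (LINT x|\<mu>B. indicator {0..<1} x * h (x + 1))"
proof -
  have K: "0 \<le> K"
    using h[of 0] norm_ge_zero order_trans by blast
  have "(LINT x|\<mu>B. indicator {1..<2} x * h x) =
      ((LINT x|\<mu>B. 0) + (LINT x|\<mu>B. 0) + (LINT x|\<mu>B. h ((x + 4) / 4)) + (LINT x|\<mu>B. h ((x + 5) / 4))) / 4"
    by (rule integral_\<mu>B_piecewise[where K = K]) (use h K in \<open>auto simp: norm_mult indicator_def\<close>)
  moreover have "(LINT x|\<mu>B. indicator {0..<1} x * h (x + 1)) =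
      ((LINT x|\<mu>B. h ((x + 4) / 4)) + (LINT x|\<mu>B. h ((x + 5) / 4)) + (LINT x|\<mu>B. 0) + (LINT x|\<mu>B. 0)) / 4"
    by (rule integral_\<mu>B_piecewise[where K = K])
       (use h K in \<open>auto simp: norm_mult indicator_def add_divide_distrib add.commute\<close>)
  ultimately show ?thesis
    by (simp only: Bochner_Integration.integral_zero add_0_left add_0_right)
qed

text \<open>Only the branch with digit \<open>0\<close>, applied to \<open>[0, 1)\<close>, reaches
  \<open>[0, 1/4)\<close>.\<close>

lemma integral_\<mu>B_first_quarter:
  fixes h :: "real \<Rightarrow> complex"
  assumes [measurable]: "h \<in> borel_measurable borel" and h: "\<And>x. cmod (h x) \<le> K"
  shows "(LINT x|\<mu>B. indicator {0..<1/4} x * h x) = (LINT x|\<mu>B. indicator {0..<1} x * h (x / 4)) / 4"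
proof -
  have K: "0 \<le> K"
    using h[of 0] norm_ge_zero order_trans by blast
  have "(LINT x|\<mu>B. indicator {0..<1/4} x * h x) =
      ((LINT x|\<mu>B. indicator {0..<1} x * h (x / 4)) + (LINT x|\<mu>B. 0) + (LINT x|\<mu>B. 0) + (LINT x|\<mu>B. 0)) / 4"
    by (rule integral_\<mu>B_piecewise[where K = K]) (use h K in \<open>auto simp: norm_mult indicator_def\<close>)
  then show ?thesis
    by simp
qed

text \<open>This is the overlap: \<open>[1/4, 1/2)\<close> is reached by digit \<open>0\<close> from
  \<open>[1, 2)\<close> and by digit \<open>1\<close> from \<open>[0, 1)\<close>, with equal
  contributions. Hence the factor \<open>2\<close>.\<close>

lemma integral_\<mu>B_second_quarter:
  fixes h :: "real \<Rightarrow> complex"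
  assumes [measurable]: "h \<in> borel_measurable borel" and h: "\<And>x. cmod (h x) \<le> K"
  shows "(LINT x|\<mu>B. indicator {1/4..<1/2} x * h x) =
    2 * (LINT x|\<mu>B. indicator {0..<1/4} x * h (x + 1/4))"
proof -
  have K: "0 \<le> K"
    using h[of 0] norm_ge_zero order_trans by blast
  have "(LINT x|\<mu>B. indicator {1/4..<1/2} x * h x) =
      ((LINT x|\<mu>B. indicator {1..<2} x * h (x / 4)) + (LINT x|\<mu>B. indicator {0..<1} x * h ((x + 1) / 4))
        + (LINT x|\<mu>B. 0) + (LINT x|\<mu>B. 0)) / 4"
    by (rule integral_\<mu>B_piecewise[where K = K]) (use h K in \<open>auto simp: norm_mult indicator_def\<close>)
  also have "(LINT x|\<mu>B. indicator {1..<2} x * h (x / 4)) =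
      (LINT x|\<mu>B. indicator {0..<1} x * h ((x + 1) / 4))"
    by (rule integral_\<mu>B_translate_1) (use h in auto)
  \<comment> \<open>The first-quarter formula is used backwards, for the translate of
    \<open>h\<close> by \<open>1/4\<close>.\<close>
  also have "(LINT x|\<mu>B. indicator {0..<1} x * h ((x + 1) / 4)) =
      4 * (LINT x|\<mu>B. indicator {0..<1/4} x * h (x + 1/4))"
    by (subst integral_\<mu>B_first_quarter[of "\<lambda>x. h (x + 1/4)" K]) (use h in \<open>auto simp: add_divide_distrib\<close>)
  finally show ?thesis
    by simp
qed

lemma integral_indicator_complex:
  assumes "A \<in> sets M"
  shows "(LINT x|M. (indicator A x :: complex)) = of_real (measure M A)"
proof -
  have "(LINT x|M. (indicator A x :: complex)) = (LINT x|M. complex_of_real (indicator A x))"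
    by (intro Bochner_Integration.integral_cong refl) (simp add: indicator_def)
  also have "\<dots> = of_real (measure M A)"
    using sets.sets_into_space[OF assms] by (simp add: Int_absorb2)
  finally show ?thesis .
qed

text \<open>\<open>[0, 1)\<close> and its translate \<open>[1, 2)\<close> share the total mass
  equally, and the first quarter receives a fourth of one half. Positivity of this value is what
  yields the final contradiction.\<close>

lemma measure_\<mu>B_first_quarter: "measure \<mu>B {0..<1/4} = 1 / 8"
proof -
  interpret real_distribution \<mu>B
    by (rule real_distribution_ifs_measure)
  have "measure \<mu>B {0..<1} + measure \<mu>B {1..<2} = measure \<mu>B ({0..<1} \<union> {1..<2})"
    by (rule finite_measure_Union[symmetric]) auto
  also have "\<dots> = 1"
    by (subst prob_eq_1) (use AE_\<mu>B in auto)
  finally have "measure \<mu>B {0..<1} + measure \<mu>B {1..<2} = 1" .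
  moreover have "measure \<mu>B {1..<2} = measure \<mu>B {0..<1}"
    using integral_\<mu>B_translate_1[of "\<lambda>_. 1" 1] by (simp add: integral_indicator_complex)
  moreover have "complex_of_real (measure \<mu>B {0..<1/4}) = of_real (measure \<mu>B {0..<1} / 4)"
    using integral_\<mu>B_first_quarter[of "\<lambda>_. 1" 1] by (simp add: integral_indicator_complex)
  ultimately show ?thesis
    unfolding of_real_eq_iff by simp
qed

section \<open>Failure of spectrality\<close>

lemma not_spectral_\<mu>B: "\<not> spectral_measure \<mu>B"
proof
  interpret real_distribution \<mu>B
    by (rule real_distribution_ifs_measure)
  assume "spectral_measure \<mu>B"
  then obtain \<Lambda> where basis: "L2_orthogonal_basis \<mu>B expo \<Lambda>"
    by (auto simp: spectral_measure_def)
  \<comment> \<open>The factor \<open>2\<close> matches the doubled mass on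
    \<open>[1/4, 1/2)\<close>, so coefficients differ only by a phase. The squared norms are
    nevertheless \<open>1/2\<close> for \<open>f\<close> and \<open>1/4\<close> for
    \<open>g\<close>.\<close>
  define f where "f x = 2 * (indicator {0..<1/4} x :: complex)" for x :: real
  define g where "g x = (indicator {1/4..<1/2} x :: complex)" for x :: real
  have f: "square_integrable \<mu>B f"
    by (rule square_integrable_bounded[of _ 2]) (auto simp: f_def[abs_def] indicator_def norm_mult)
  have g: "square_integrable \<mu>B g"
    by (rule square_integrable_bounded[of _ 1]) (auto simp: g_def[abs_def] indicator_def)
  have inner: "L2_inner \<mu>B g (expo l) = cnj (expo l (1/4)) * L2_inner \<mu>B f (expo l)" for l
  proof -
    have "L2_inner \<mu>B g (expo l) = 2 * (LINT x|\<mu>B. indicator {0..<1/4} x * cnj (expo l (x + 1/4)))"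
      unfolding L2_inner_def g_def
      by (rule integral_\<mu>B_second_quarter[where K = 1]) (auto simp: expo_def exp_cnj)
    also have "\<dots> = cnj (expo l (1/4)) * L2_inner \<mu>B f (expo l)"
      unfolding L2_inner_def f_def integral_mult_right_zero[symmetric]
      by (simp add: expo_add mult_ac)
    finally show ?thesis .
  qed
  have "L2_norm \<mu>B f \<le> L2_norm \<mu>B g"
    by (rule L2_orthogonal_basis_norm_mono[OF basis L2_norm_expo f g]) (simp add: inner norm_mult)
  then have "(L2_norm \<mu>B f)\<^sup>2 \<le> (L2_norm \<mu>B g)\<^sup>2"
    by (simp add: power_mono L2_norm_nonneg)
  moreover have "(\<lambda>x. (cmod (f x))\<^sup>2) = (\<lambda>x. 4 * indicator {0..<1/4} x)"
    by (auto simp: f_def indicator_def)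
  then have "(L2_norm \<mu>B f)\<^sup>2 = 4 * measure \<mu>B {0..<1/4}"
    by (simp add: L2_norm_power2)
  moreover have "(\<lambda>x. (cmod (g x))\<^sup>2) = indicator {1/4..<1/2}"
    by (auto simp: g_def indicator_def)
  then have "(L2_norm \<mu>B g)\<^sup>2 = measure \<mu>B {1/4..<1/2}"
    by (simp add: L2_norm_power2)
  moreover have "complex_of_real (measure \<mu>B {1/4..<1/2}) = of_real (2 * measure \<mu>B {0..<1/4})"
    using integral_\<mu>B_second_quarter[of "\<lambda>_. 1" 1] by (simp add: integral_indicator_complex)
  ultimately show False
    unfolding of_real_eq_iff measure_\<mu>B_first_quarter by simp
qed

theorem proposition3p23:
  fixes B :: "real set" and \<mu> :: "real measure"
  assumes "B = {0, 1, 4, 5}"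
    and "\<mu> = invariant_measure 4 B"
  shows "\<not> spectral_measure \<mu> \<and>
    (\<exists>\<Lambda> :: real set. infinite \<Lambda> \<and> L2_orthonormal \<mu> expo \<Lambda>)"
proof -
  have "\<mu> = \<mu>B"
    using assms by (simp add: invariant_measure_eq)
  moreover have "infinite (range (\<lambda>k. 4 ^ k / 2 :: real))"
    by (rule range_inj_infinite) (auto simp: inj_def)
  ultimately show ?thesis
    using not_spectral_\<mu>B \<mu>B_orthonormal_expo by blast
qed

end
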